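(* Let $n\ge1$ be a fixed degree. The asymptotic error of the unitary best approximation satisfies $$\min_{u\in\mathcal{U}_n}\| u - \exp(\omega\cdot)\| = \frac{2(n!)^2}{(2n)!(2n+1)!} \left( \frac{\omega }{2} \right)^{2n+1} + \mathcal{O}(\omega^{2n+2}),\quad \omega\to 0^+.$$
   Context: For a complex polynomial $p$ let $p^\dag(z):=\overline{p}(-z)=\overline{p(-\overline z)}$, where $\overline p$ has complex-conjugated coefficients. Let $\mathcal{U}_n:=\{p^\dag/p : p \text{ a complex polynomial of degree}\le n,\ p\not\equiv 0\}$, with rational functions identified with their irreducible form; then $|u(\mathrm{i}x)|=1$ for $u\in\mathcal{U}_n$, $x\in\mathbb{R}$. For $u\in\mathcal{U}_n$, $\|u-\exp(\omega\cdot)\|:=\max_{x\in[-1,1]}|u(\mathrm{i}x)-\mathrm{e}^{\mathrm{i}\omega x}|$. The minimum over $\mathcal{U}_n$ is attained for every $\omega>0$. *)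

theory Defs
  imports
    "HOL-Analysis.Analysis"
    "HOL-Computational_Algebra.Polynomial_Factorial"
    "HOL-Computational_Algebra.Field_as_Ring"
    "HOL-Library.Landau_Symbols"
begin

definition poly_dag :: "complex poly \<Rightarrow> complex poly" where
  "poly_dag p = pcompose (map_poly cnj p) [:0, -1:]"

lemma poly_poly_dag: "poly (poly_dag p) z = cnj (poly p (- cnj z))"
  by (simp add: poly_dag_def poly_pcompose)

text \<open>Rational functions are elements of the fraction field of the polynomial ring, and
  are evaluated through their irreducible form, so that removable singularities of a
  representative \<open>p\<^sup>\<dagger>/p\<close> (common zeros on the imaginary axis) play no role.\<close>

definition unitary_rat :: "nat \<Rightarrow> complex poly fract set" where
  "unitary_rat n = {Fraction_Field.Fract (poly_dag p) p |p. degree p \<le> n \<and> p \<noteq> 0}"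

definition rat_eval :: "complex poly fract \<Rightarrow> complex \<Rightarrow> complex" where
  "rat_eval u z = poly (fst (quot_of_fract u)) z / poly (snd (quot_of_fract u)) z"

text \<open>The supremum and the infimum below are the maximum and the minimum, see the lemmas
  \<open>unitary_error_attained\<close> and \<open>min_unitary_error_attained\<close>.\<close>

definition unitary_error :: "real \<Rightarrow> complex poly fract \<Rightarrow> real" where
  "unitary_error \<omega> u = (SUP x\<in>{-1..1}. cmod (rat_eval u (\<i> * of_real x) - exp (\<i> * of_real (\<omega> * x))))"

definition min_unitary_error :: "nat \<Rightarrow> real \<Rightarrow> real" where
  "min_unitary_error n \<omega> = (INF u\<in>unitary_rat n. unitary_error \<omega> u)"

lemma finite_imag_axis_roots:
  fixes p :: "complex poly"
  assumes "p \<noteq> 0"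
  shows "finite {x::real. poly p (\<i> * of_real x) = 0}"
proof -
  have "inj (\<lambda>x::real. \<i> * complex_of_real x)" by (auto intro!: injI)
  from finite_vimageI[OF poly_roots_finite[OF assms] this]
  show ?thesis by (simp add: vimage_def)
qed

lemma closed_cofinite_UNIV:
  fixes S :: "real set"
  assumes "closed S" "finite F" "- F \<subseteq> S"
  shows "S = UNIV"
proof (rule ccontr)
  assume "S \<noteq> UNIV"
  then obtain x where "x \<in> - S" by auto
  moreover have "open (- S)" using assms by auto
  moreover have "finite (- S)" using assms by (metis compl_le_swap2 finite_subset)
  ultimately show False using finite_imp_not_open by blast
qed

lemma rat_eval_Fract:
  assumes "p \<noteq> 0" "poly p z \<noteq> 0"
  shows "rat_eval (Fraction_Field.Fract q p) z = poly q z / poly p z"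
proof -
  obtain d where d: "q = fst (normalize_quot (q, p)) * d" "p = snd (normalize_quot (q, p)) * d"
    using normalize_quotE[OF assms(1), of q] by metis
  have "quot_of_fract (Fraction_Field.Fract q p) = normalize_quot (q, p)"
    using assms(1) by (simp add: quot_of_fract_quot_to_fract[of "(q,p)", unfolded quot_to_fract_def, simplified])
  moreover have "poly q z = poly (fst (normalize_quot (q, p))) z * poly d z"
     "poly p z = poly (snd (normalize_quot (q, p))) z * poly d z"
    using d by (metis poly_mult)+
  ultimately show ?thesis using assms by (auto simp: rat_eval_def)
qed

lemma unitary_rat_axis:
  assumes "u \<in> unitary_rat n"
  shows "poly (snd (quot_of_fract u)) (\<i> * of_real x) \<noteq> 0"
    and "cmod (rat_eval u (\<i> * of_real x)) = 1"
proof -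
  obtain p where p: "p \<noteq> 0" "u = Fraction_Field.Fract (poly_dag p) p"
    using assms by (auto simp: unitary_rat_def)
  define a b where "a = fst (quot_of_fract u)" and "b = snd (quot_of_fract u)"
  have "quot_of_fract u = normalize_quot (poly_dag p, p)" unfolding p(2)
    using p(1) by (simp add: quot_of_fract_quot_to_fract[of "(poly_dag p,p)", unfolded quot_to_fract_def, simplified])
  then obtain d where d: "poly_dag p = a * d" "p = b * d" 
    using normalize_quotE[OF p(1), of "poly_dag p"] unfolding a_def b_def by metis
  have cop: "coprime a b" unfolding a_def b_def by (rule coprime_quot_of_fract)
  let ?S = "{x::real. cmod (poly a (\<i> * of_real x)) = cmod (poly b (\<i> * of_real x))}"
  have "?S = UNIV"
  proof (rule closed_cofinite_UNIV)
    show "closed ?S" by (intro closed_Collect_eq continuous_intros)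
    show "finite {x::real. poly p (\<i> * of_real x) = 0}" by (rule finite_imag_axis_roots[OF p(1)])
    show "- {x::real. poly p (\<i> * of_real x) = 0} \<subseteq> ?S"
    proof safe
      fix y :: real assume "poly p (\<i> * of_real y) \<noteq> 0"
      moreover have "cmod (poly (poly_dag p) (\<i> * of_real y)) = cmod (poly p (\<i> * of_real y))"
        by (simp add: poly_poly_dag)
      ultimately show "cmod (poly a (\<i> * of_real y)) = cmod (poly b (\<i> * of_real y))"
        by (metis d poly_mult norm_mult mult_cancel_right norm_eq_zero mult_zero_right)
    qed
  qed
  hence eq: "cmod (poly a (\<i> * of_real x)) = cmod (poly b (\<i> * of_real x))" by auto
  have nz: "poly b (\<i> * of_real x) \<noteq> 0"
  proof
    assume "poly b (\<i> * of_real x) = 0"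
    moreover from this have "poly a (\<i> * of_real x) = 0" using eq by simp
    ultimately have "[:- (\<i> * of_real x), 1:] dvd a" "[:- (\<i> * of_real x), 1:] dvd b"
      by (simp_all add: poly_eq_0_iff_dvd)
    hence "is_unit [:- (\<i> * of_real x), 1:]" using cop coprime_common_divisor by blast
    thus False by (simp add: is_unit_iff_degree)
  qed
  thus "poly (snd (quot_of_fract u)) (\<i> * of_real x) \<noteq> 0" by (simp add: b_def)
  show "cmod (rat_eval u (\<i> * of_real x)) = 1"
    using eq nz by (simp add: rat_eval_def a_def[symmetric] b_def[symmetric] norm_divide)
qed

lemma unitary_rat_continuous:
  assumes "u \<in> unitary_rat n"
  shows "continuous_on S (\<lambda>x. cmod (rat_eval u (\<i> * of_real x) - exp (\<i> * of_real (\<omega> * x))))"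
  unfolding rat_eval_def
  by (intro continuous_intros ballI unitary_rat_axis(1)[OF assms])

lemma unitary_error_attained:
  assumes "u \<in> unitary_rat n"
  obtains x where "x \<in> {-1..1}"
    "unitary_error \<omega> u = cmod (rat_eval u (\<i> * of_real x) - exp (\<i> * of_real (\<omega> * x)))"
    "\<And>y. y \<in> {-1..1} \<Longrightarrow> cmod (rat_eval u (\<i> * of_real y) - exp (\<i> * of_real (\<omega> * y))) \<le> unitary_error \<omega> u"
proof -
  let ?f = "\<lambda>x. cmod (rat_eval u (\<i> * of_real x) - exp (\<i> * of_real (\<omega> * x)))"
  have "\<exists>x\<in>{-1..1}. \<forall>y\<in>{-1..1}. ?f y \<le> ?f x"
    by (rule continuous_attains_sup[OF _ _ unitary_rat_continuous[OF assms]]) auto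
  then obtain x where x: "x \<in> {-1..1}" "\<And>y. y \<in> {-1..1} \<Longrightarrow> ?f y \<le> ?f x" by blast
  have "unitary_error \<omega> u = ?f x"
    unfolding unitary_error_def by (rule cSup_eq_maximum) (use x in auto)
  with x show ?thesis by (intro that[of x]) auto
qed

lemma min_unitary_error_attained:
  obtains u where "u \<in> unitary_rat n" "min_unitary_error n \<omega> = unitary_error \<omega> u"
    "\<And>v. v \<in> unitary_rat n \<Longrightarrow> unitary_error \<omega> u \<le> unitary_error \<omega> v"
proof -
  define m where "m = min_unitary_error n \<omega>"
  have ne: "unitary_rat n \<noteq> {}"
    unfolding unitary_rat_def by (auto intro!: exI[of _ 1])
  have nonneg: "0 \<le> unitary_error \<omega> v" if v: "v \<in> unitary_rat n" for v
    using unitary_error_attained[OF v, of \<omega>] norm_ge_zero by metis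
  have bdd: "bdd_below (unitary_error \<omega> ` unitary_rat n)"
    by (rule bdd_belowI[of _ 0]) (use nonneg in auto)
  have m_le: "m \<le> unitary_error \<omega> v" if "v \<in> unitary_rat n" for v
    unfolding m_def min_unitary_error_def by (rule cINF_lower[OF bdd that])
  have "\<exists>p. p \<noteq> 0 \<and> degree p \<le> n \<and> (\<Sum>i\<le>n. cmod (coeff p i)) = 1 \<and>
      unitary_error \<omega> (Fraction_Field.Fract (poly_dag p) p) < m + 1 / real (Suc k)" for k
  proof -
    have "m < m + 1 / real (Suc k)" by simp
    then obtain v where v: "v \<in> unitary_rat n" "unitary_error \<omega> v < m + 1 / real (Suc k)"
      using cINF_less_iff[OF ne bdd] unfolding m_def min_unitary_error_def by blast
    then obtain q where q: "q \<noteq> 0" "degree q \<le> n" "v = Fraction_Field.Fract (poly_dag q) q"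
      by (auto simp: unitary_rat_def)
    define s where "s = (\<Sum>i\<le>n. cmod (coeff q i))"
    have "cmod (coeff q (degree q)) \<le> s"
      unfolding s_def by (rule member_le_sum) (use q in auto)
    hence s: "s > 0" using q(1) by (smt (verit) leading_coeff_0_iff zero_less_norm_iff)
    define p where "p = smult (of_real (1 / s)) q"
    have "poly_dag p = smult (of_real (1 / s)) (poly_dag q)"
      by (simp add: poly_eq_poly_eq_iff[symmetric] fun_eq_iff poly_poly_dag p_def)
    hence "Fraction_Field.Fract (poly_dag p) p = v"
      using q s unfolding p_def by (simp add: eq_fract)
    moreover have "(\<Sum>i\<le>n. cmod (coeff p i)) = 1"
      using s by (simp add: p_def norm_divide norm_mult s_def[symmetric] flip: sum_divide_distrib)
    moreover have "p \<noteq> 0" "degree p \<le> n" using q s by (auto simp: p_def)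
    ultimately show ?thesis using v(2) by blast
  qed
  then obtain P where P: "\<And>k. P k \<noteq> 0" "\<And>k. degree (P k) \<le> n"
      "\<And>k. (\<Sum>i\<le>n. cmod (coeff (P k) i)) = 1"
      "\<And>k. unitary_error \<omega> (Fraction_Field.Fract (poly_dag (P k)) (P k)) < m + 1 / real (Suc k)"
    by metis
  have "\<exists>l r. strict_mono (r::nat \<Rightarrow> nat) \<and> (\<forall>i<N. (\<lambda>k. coeff (P (r k)) i) \<longlonglongrightarrow> l i)"
    if "N \<le> Suc n" for N
    using that
  proof (induction N)
    case 0
    show ?case by (auto intro!: exI[of _ id] strict_monoI)
  next
    case (Suc N)
    then obtain l r where lr: "strict_mono (r::nat \<Rightarrow> nat)"
      "\<And>i. i < N \<Longrightarrow> (\<lambda>k. coeff (P (r k)) i) \<longlonglongrightarrow> l i" by auto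
    have "cmod (coeff (P k) N) \<le> (\<Sum>i\<le>n. cmod (coeff (P k) i))" for k
      by (rule member_le_sum) (use Suc.prems in auto)
    hence "bounded (range (\<lambda>k. coeff (P (r k)) N))"
      unfolding bounded_iff P(3) by (intro exI[of _ 1]) auto
    then obtain c r' where r': "strict_mono (r'::nat \<Rightarrow> nat)"
      "((\<lambda>k. coeff (P (r k)) N) \<circ> r') \<longlonglongrightarrow> c"
      using bounded_imp_convergent_subsequence by blast
    have "(\<lambda>k. coeff (P ((r \<circ> r') k)) i) \<longlonglongrightarrow> (l(N := c)) i" if "i < Suc N" for i
    proof (cases "i = N")
      case True
      then show ?thesis using r' by (simp add: o_def)
    next
      case False
      then show ?thesis using LIMSEQ_subseq_LIMSEQ[OF lr(2) r'(1), of i] that by (simp add: o_def)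
    qed
    thus ?case using strict_mono_o[OF lr(1) r'(1)] by blast
  qed
  from this[of "Suc n"] obtain l r where r: "strict_mono (r::nat \<Rightarrow> nat)"
      and l: "\<And>i. i \<le> n \<Longrightarrow> (\<lambda>k. coeff (P (r k)) i) \<longlonglongrightarrow> l i"
    by (auto simp: less_Suc_eq_le)
  define p where "p = (\<Sum>i\<le>n. monom (l i) i)"
  have cp: "coeff p i = (if i \<le> n then l i else 0)" for i
    by (simp add: p_def coeff_sum)
  have degp: "degree p \<le> n" by (rule degree_le) (simp add: cp)
  have "(\<lambda>k. \<Sum>i\<le>n. cmod (coeff (P (r k)) i)) \<longlonglongrightarrow> (\<Sum>i\<le>n. cmod (l i))"
    by (intro tendsto_intros l) auto
  hence "(\<Sum>i\<le>n. cmod (l i)) = 1" unfolding P(3) by (simp add: LIMSEQ_const_iff)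
  hence p0: "p \<noteq> 0" using cp by (metis (no_types, lifting) atMost_iff coeff_0 norm_zero sum.neutral zero_neq_one)
  have poly_sum: "poly q z = (\<Sum>i\<le>n. coeff q i * z ^ i)" if "degree q \<le> n" for q :: "complex poly" and z
    unfolding poly_altdef by (rule sum.mono_neutral_left) (use that in \<open>auto intro: coeff_eq_0\<close>)
  have lim: "(\<lambda>k. poly (P (r k)) z) \<longlonglongrightarrow> poly p z" for z
    unfolding poly_sum[OF P(2)] poly_sum[OF degp] by (intro tendsto_intros) (auto simp: cp l)
  define u where "u = Fraction_Field.Fract (poly_dag p) p"
  have u: "u \<in> unitary_rat n" using p0 degp by (auto simp: unitary_rat_def u_def)
  let ?f = "\<lambda>v x. cmod (rat_eval v (\<i> * of_real x) - exp (\<i> * of_real (\<omega> * x)))"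
  have main: "?f u x \<le> m" if x: "x \<in> {-1..1}" "poly p (\<i> * of_real x) \<noteq> 0" for x
  proof -
    let ?z = "\<i> * complex_of_real x"
    let ?e = "exp (\<i> * of_real (\<omega> * x))"
    have "(\<lambda>k. cmod (poly (poly_dag (P (r k))) ?z / poly (P (r k)) ?z - ?e))
        \<longlonglongrightarrow> cmod (poly (poly_dag p) ?z / poly p ?z - ?e)"
      unfolding poly_poly_dag by (intro tendsto_intros lim x)
    moreover have "(\<lambda>k. m + 1 / real (Suc (r k))) \<longlonglongrightarrow> m"
      using LIMSEQ_subseq_LIMSEQ[OF LIMSEQ_inverse_real_of_nat_add[of m] r]
      by (simp add: o_def inverse_eq_divide)
    moreover have "eventually (\<lambda>k. poly (P (r k)) ?z \<noteq> 0) sequentially"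
      using tendsto_imp_eventually_ne[OF lim x(2)] .
    hence "eventually (\<lambda>k. cmod (poly (poly_dag (P (r k))) ?z / poly (P (r k)) ?z - ?e)
        \<le> m + 1 / real (Suc (r k))) sequentially"
    proof eventually_elim
      case (elim k)
      let ?v = "Fraction_Field.Fract (poly_dag (P (r k))) (P (r k))"
      have "?v \<in> unitary_rat n" using P by (auto simp: unitary_rat_def)
      hence "?f ?v x \<le> unitary_error \<omega> ?v" using unitary_error_attained x(1) by metis
      also have "\<dots> < m + 1 / real (Suc (r k))" by (rule P(4))
      finally show ?case using rat_eval_Fract[OF P(1) elim] by simp
    qed
    ultimately have "cmod (poly (poly_dag p) ?z / poly p ?z - ?e) \<le> m"
      using tendsto_le[OF sequentially_bot] by blast
    thus ?thesis using rat_eval_Fract[OF p0 x(2)] by (simp add: u_def)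
  qed
  have all: "?f u x \<le> m" if "x \<in> {-1<..<1}" for x
  proof (rule ccontr)
    assume *: "\<not> ?f u x \<le> m"
    have "open {y. m < ?f u y}"
      by (intro open_Collect_less continuous_on_const unitary_rat_continuous[OF u])
    hence "open ({y. m < ?f u y} \<inter> {-1<..<1})" by auto
    moreover have "x \<in> {y. m < ?f u y} \<inter> {-1<..<1}" using * that by auto
    moreover have "{y. m < ?f u y} \<inter> {-1<..<1} \<subseteq> {x::real. poly p (\<i> * of_real x) = 0}"
    proof
      fix y assume "y \<in> {y. m < ?f u y} \<inter> {-1<..<1}"
      hence "\<not> ?f u y \<le> m" "y \<in> {-1..1}" by auto
      with main[of y] show "y \<in> {x::real. poly p (\<i> * of_real x) = 0}" by blast
    qed
    hence "finite ({y. m < ?f u y} \<inter> {-1<..<1})"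
      using finite_imag_axis_roots[OF p0] finite_subset by blast
    ultimately show False using finite_imp_not_open by blast
  qed
  have "closed {y. ?f u y \<le> m}"
    by (intro closed_Collect_le continuous_on_const unitary_rat_continuous[OF u])
  hence "closure {-1<..<1} \<subseteq> {y. ?f u y \<le> m}" using all by (intro closure_minimal) auto
  hence "?f u x \<le> m" if "x \<in> {-1..1}" for x using that by auto
  hence "unitary_error \<omega> u \<le> m" using unitary_error_attained[OF u] by metis
  with m_le[OF u] have "m = unitary_error \<omega> u" by simp
  with u m_le show ?thesis by (intro that[of u]) (auto simp: m_def)
qed

end

theory Submission
  imports Defs
begin

text \<open>
  On the imaginary axis \<open>u = p\<^sup>\<dagger>/p\<close> takes the value \<open>cnj (p (\<i>x)) / p (\<i>x)\<close>, so with
  \<open>W x = p (\<i>x) * exp (\<i>\<omega>x/2)\<close> the pointwise error equals \<open>2 * \<bar>Im (W x)\<bar> / \<bar>W x\<bar>\<close>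
  (\<open>error_eq_twisted\<close>). The approximation problem becomes: make the phase of \<open>W\<close> small.

  Upper and lower bound both come from a single explicit \<open>p\<close> whose phase error is almost a
  Chebyshev polynomial. Put \<open>s = \<omega>/2\<close>. The (reflected) reverse Bessel polynomials \<open>\<theta>\<^sub>k\<close> satisfy
  \<open>Im (\<theta>\<^sub>k (\<i>y) * exp (\<i>y)) = y^(2k+1) / (2k+1)!! + O(y^(2k+3))\<close> (\<open>riccati_asymp\<close>); thus
  \<open>\<theta>\<^sub>n (sz)\<close> alone gives the diagonal Pade approximant, with phase error proportional to
  \<open>(sx)^(2n+1)\<close>. Adding multiples of \<open>s^(2(n-k)) * \<theta>\<^sub>k (sz)\<close> for \<open>k < n\<close>, whose phase errors
  have the same order \<open>s^(2n+1)\<close> but are proportional to \<open>x^(2k+1)\<close>, one can replace the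
  monomial \<open>x^(2n+1)\<close> by the odd polynomial \<open>T\<^sub>2\<^sub>n\<^sub>+\<^sub>1\<close>; the added terms vanish with \<open>s\<close>, so
  \<open>W\<close> still tends to a positive constant \<open>G\<close>. Scaled so that the phase errors add up, to leading order, to
  \<open>s^(2n+1) T\<^sub>2\<^sub>n\<^sub>+\<^sub>1\<close>, the result (\<open>trial_ratio\<close>) is
  \<open>Im W / \<bar>W\<bar> = s^(2n+1) T\<^sub>2\<^sub>n\<^sub>+\<^sub>1 / G + O(s^(2n+2))\<close>
  with \<open>G = 4^n (2n-1)!! (2n+1)!!\<close>, and \<open>2 s^(2n+1) / G\<close> is the claimed leading term.

  As \<open>\<bar>T\<^sub>2\<^sub>n\<^sub>+\<^sub>1\<bar> \<le> 1\<close>, this \<open>p\<close> proves the upper bound. As \<open>T\<^sub>2\<^sub>n\<^sub>+\<^sub>1\<close> attains the values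
  \<open>\<plusminus>1\<close> alternately at \<open>2n+2\<close> points, it also proves the lower bound, by an argument of
  de la Vallee Poussin (\<open>unitary_error_ge_alternation\<close>): if \<open>q\<^sup>\<dagger>/q\<close> had a smaller error than
  all of those alternating errors, then the polynomial \<open>q\<^sup>\<dagger> p - q p\<^sup>\<dagger>\<close>, of degree at most
  \<open>2n\<close>, would be non-zero with \<open>2n+1\<close> zeros on the imaginary axis.
\<close>

section \<open>The error as an imaginary part\<close>

definition twisted :: "real \<Rightarrow> complex poly \<Rightarrow> real \<Rightarrow> complex" where
  "twisted \<omega> p x = poly p (\<i> * of_real x) * exp (\<i> * of_real (\<omega> * x / 2))"

lemma continuous_on_twisted [continuous_intros]: "continuous_on S (twisted \<omega> p)"
  unfolding twisted_def by (intro continuous_intros) auto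

lemma norm_twisted: "cmod (twisted \<omega> p x) = cmod (poly p (\<i> * of_real x))"
  by (simp add: twisted_def norm_mult)

text \<open>Multiplying by the unimodular \<open>cnj e\<close> turns the difference into
  \<open>(cnj (a * e) - a * e) / a\<close>.\<close>

lemma cmod_cnj_div_minus_square:
  fixes a e :: complex
  assumes "a \<noteq> 0" "cmod e = 1"
  shows "cmod (cnj a / a - e\<^sup>2) = 2 * \<bar>Im (a * e)\<bar> / cmod a"
proof -
  have e: "e * cnj e = 1"
    using assms(2) by (simp add: complex_norm_square[symmetric])
  have "cnj a / a - e\<^sup>2 = - e * (a * e - cnj (a * e)) / a"
    using assms(1) e by (simp add: field_simps power2_eq_square)
  also have "a * e - cnj (a * e) = of_real (2 * Im (a * e)) * \<i>"
    by (rule complex_diff_cnj)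
  also have "cmod (- e * (of_real (2 * Im (a * e)) * \<i>) / a) = cmod e * \<bar>2 * Im (a * e)\<bar> / cmod a"
    by (simp only: norm_mult norm_divide norm_minus_cancel norm_of_real norm_ii mult_1_right)
  finally show ?thesis
    by (simp only: assms(2) mult_1 abs_mult abs_numeral)
qed

lemma error_eq_twisted:
  assumes "poly p (\<i> * of_real x) \<noteq> 0"
  shows "cmod (rat_eval (Fraction_Field.Fract (poly_dag p) p) (\<i> * of_real x) - exp (\<i> * of_real (\<omega> * x)))
    = 2 * \<bar>Im (twisted \<omega> p x)\<bar> / cmod (twisted \<omega> p x)"
proof -
  define e where "e = exp (\<i> * of_real (\<omega> * x / 2))"
  have e: "cmod e = 1" "exp (\<i> * of_real (\<omega> * x)) = e\<^sup>2"
    by (simp_all add: e_def flip: exp_double)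
  have p: "p \<noteq> 0" using assms by auto
  have "rat_eval (Fraction_Field.Fract (poly_dag p) p) (\<i> * of_real x)
      = cnj (poly p (\<i> * of_real x)) / poly p (\<i> * of_real x)"
    by (simp add: rat_eval_Fract[OF p assms] poly_poly_dag)
  then show ?thesis
    using cmod_cnj_div_minus_square[OF assms e(1)] e(2)
    by (simp add: norm_twisted) (simp add: twisted_def e_def)
qed

lemma degree_poly_dag_le: "degree (poly_dag p) \<le> degree p"
  by (simp add: poly_dag_def degree_map_poly degree_pcompose)

text \<open>A zero of \<open>p\<close> on the imaginary axis is cancelled by \<open>p\<^sup>\<dagger>\<close>, because the linear factor
  \<open>l = z - \<i>x\<close> satisfies \<open>l\<^sup>\<dagger> = - l\<close>. Dividing it out changes the sign of the fraction, which
  the factor \<open>\<i>\<close> in front of the quotient restores.\<close>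

lemma unitary_rat_zero_free:
  assumes "u \<in> unitary_rat n"
  obtains p where "degree p \<le> n" "\<And>x. poly p (\<i> * of_real x) \<noteq> 0"
    "u = Fraction_Field.Fract (poly_dag p) p"
proof -
  have "\<exists>q. degree q \<le> n \<and> (\<forall>x. poly q (\<i> * of_real x) \<noteq> 0) \<and>
      Fraction_Field.Fract (poly_dag p) p = Fraction_Field.Fract (poly_dag q) q"
    if "degree p \<le> n" "p \<noteq> 0" for p
    using that
  proof (induction "degree p" arbitrary: p rule: less_induct)
    case less
    show ?case
    proof (cases "\<forall>x. poly p (\<i> * of_real x) \<noteq> 0")
      case True
      then show ?thesis using less.prems by blast
    next
      case False
      then obtain x where "poly p (\<i> * of_real x) = 0" by auto
      then obtain q where q: "p = [:- (\<i> * of_real x), 1:] * q"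
        unfolding poly_eq_0_iff_dvd by (auto elim: dvdE)
      define r where "r = smult \<i> q"
      have q0: "q \<noteq> 0" using less.prems(2) q by auto
      have "degree p = Suc (degree q)"
        unfolding q using q0 by (subst degree_mult_eq) auto
      then have deg: "degree r < degree p" "degree r \<le> n" "r \<noteq> 0"
        using less.prems q0 by (auto simp: r_def)
      have "poly_dag p * r = poly_dag r * p"
        by (simp add: poly_eq_poly_eq_iff[symmetric] fun_eq_iff poly_poly_dag q r_def algebra_simps)
      then have "Fraction_Field.Fract (poly_dag p) p = Fraction_Field.Fract (poly_dag r) r"
        using less.prems(2) deg(3) by (simp add: eq_fract)
      with less.hyps[OF deg] show ?thesis by auto
    qed
  qed
  then show ?thesis using assms that unfolding unitary_rat_def by blast
qed

section \<open>A lower bound from alternation\<close>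

text \<open>The sign changes are those of a real function \<open>f\<close>, but they are counted as zeros of a
  complex polynomial on the imaginary axis; this keeps the root bound within complex
  polynomials.\<close>

lemma alternation_imp_degree_ge:
  fixes E :: "complex poly" and f :: "real \<Rightarrow> real" and X :: "nat \<Rightarrow> real"
  assumes cont: "continuous_on UNIV f"
    and zero: "\<And>x. f x = 0 \<Longrightarrow> poly E (\<i> * of_real x) = 0"
    and E: "E \<noteq> 0"
    and X: "\<And>j. j < m \<Longrightarrow> X (Suc j) < X j"
    and alt: "\<And>j. j \<le> m \<Longrightarrow> 0 < \<sigma> * (-1) ^ j * f (X j)"
  shows "m \<le> degree E"
proof -
  have "\<exists>r. X (Suc j) < r \<and> r < X j \<and> f r = 0" if j: "j < m" for j
  proof -
    have s: "0 < \<sigma> * (-1) ^ j * f (X j)" "\<sigma> * (-1) ^ j * f (X (Suc j)) < 0"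
      using alt[of j] alt[of "Suc j"] j by auto
    let ?g = "\<lambda>x. \<sigma> * (-1) ^ j * f x"
    have "\<exists>r\<ge>X (Suc j). r \<le> X j \<and> ?g r = 0"
      by (rule IVT') (use s X[OF j] in \<open>auto intro!: continuous_intros continuous_on_subset[OF cont]\<close>)
    then obtain r where r: "X (Suc j) \<le> r" "r \<le> X j" "?g r = 0" by auto
    have "r \<noteq> X (Suc j)" "r \<noteq> X j" using r(3) s by auto
    moreover have "f r = 0" using r(3) s by auto
    ultimately show ?thesis using r by (intro exI[of _ r]) auto
  qed
  then obtain r where r: "\<And>j. j < m \<Longrightarrow> X (Suc j) < r j \<and> r j < X j \<and> f (r j) = 0"
    by metis
  have mono: "X k \<le> X j" if "j \<le> k" "k \<le> m" for j k
    using that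
  proof (induction k rule: dec_induct)
    case (step i)
    then show ?case using X[of i] by auto
  qed auto
  have less: "r k < r j" if "j < k" "k < m" for j k
    using r[of j] r[of k] mono[of "Suc j" k] that by auto
  have "inj_on r {..<m}"
    by (rule inj_onI) (metis less lessThan_iff less_irrefl linorder_neqE_nat)
  then have inj: "inj_on (\<lambda>j. \<i> * complex_of_real (r j)) {..<m}"
    by (auto simp: inj_on_def)
  have "m = card ((\<lambda>j. \<i> * complex_of_real (r j)) ` {..<m})"
    using card_image[OF inj] by simp
  also have "\<dots> \<le> card {z. poly E z = 0}"
    by (rule card_mono[OF poly_roots_finite[OF E]]) (use r zero in auto)
  also have "\<dots> \<le> degree E" by (rule card_poly_roots_bound[OF E])
  finally show ?thesis .
qed

text \<open>If the phase of \<open>w\<close> is strictly closer to the real axis than that of \<open>w0\<close>, then the sign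
  of \<open>Im (cnj w * w0) = Re w * Im w0 - Im w * Re w0\<close> is that of its first term.\<close>

lemma cross_sign:
  fixes w w0 :: complex
  assumes "\<bar>Im w\<bar> < \<delta> * cmod w" "\<delta> * cmod w0 \<le> \<bar>Im w0\<bar>" "w0 \<noteq> 0"
  shows "\<bar>Im w * Re w0\<bar> < \<bar>Re w * Im w0\<bar>"
proof -
  have "\<bar>Im w\<bar> * cmod w0 < \<delta> * cmod w * cmod w0"
    using assms by (intro mult_strict_right_mono) auto
  also have "\<dots> \<le> \<bar>Im w0\<bar> * cmod w"
    using mult_right_mono[OF assms(2), of "cmod w"] by (simp add: mult_ac)
  finally have "(\<bar>Im w\<bar> * cmod w0)\<^sup>2 < (\<bar>Im w0\<bar> * cmod w)\<^sup>2"
    by (intro power_strict_mono) auto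
  then have "(Im w * Re w0)\<^sup>2 < (Re w * Im w0)\<^sup>2"
    by (simp add: power_mult_distrib cmod_power2 algebra_simps)
  then show ?thesis by (metis abs_le_square_iff not_le)
qed

text \<open>Suppose that \<open>v = p\<^sup>\<dagger>/p\<close> has error less than \<open>2 * \<delta>\<close>. Then the phase of \<open>p\<close> stays
  away from the imaginary direction, so that \<open>Re w\<close> has a constant sign on \<open>[-1, 1]\<close>, and at
  every \<open>X j\<close> it is smaller than the phase of \<open>q\<close>. Hence \<open>Im (cnj w * w0)\<close>, in which the
  exponential factors cancel, changes sign between consecutive points: more often than a
  polynomial of degree \<open>2 * n\<close> can.\<close>

lemma unitary_error_ge_alternation:
  fixes X :: "nat \<Rightarrow> real"
  assumes v: "v \<in> unitary_rat n"
    and deg: "degree q \<le> n"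
    and X: "\<And>j. j < 2 * n + 1 \<Longrightarrow> X (Suc j) < X j"
    and X_in: "\<And>j. j \<le> 2 * n + 1 \<Longrightarrow> X j \<in> {-1..1}"
    and pos: "\<And>j. j \<le> 2 * n + 1 \<Longrightarrow> 0 < Re (twisted \<omega> q (X j))"
    and alt: "\<And>j. j \<le> 2 * n + 1 \<Longrightarrow>
      \<delta> \<le> (-1) ^ j * (Im (twisted \<omega> q (X j)) / cmod (twisted \<omega> q (X j)))"
  shows "2 * \<delta> \<le> unitary_error \<omega> v"
proof (rule ccontr)
  assume "\<not> 2 * \<delta> \<le> unitary_error \<omega> v"
  then have small: "unitary_error \<omega> v < 2 * \<delta>" by simp
  obtain p where p: "degree p \<le> n" "\<And>x. poly p (\<i> * of_real x) \<noteq> 0"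
      "v = Fraction_Field.Fract (poly_dag p) p"
    using unitary_rat_zero_free[OF v] by blast
  define w where "w = twisted \<omega> p"
  define w0 where "w0 = twisted \<omega> q"
  have w_nz: "w x \<noteq> 0" for x using p(2) by (simp add: w_def twisted_def)
  have w_im: "\<bar>Im (w x)\<bar> < \<delta> * cmod (w x)" if "x \<in> {-1..1}" for x
  proof -
    have "2 * \<bar>Im (w x)\<bar> / cmod (w x) \<le> unitary_error \<omega> v"
      unfolding w_def error_eq_twisted[OF p(2), symmetric] p(3)[symmetric]
      using unitary_error_attained[OF v] that by metis
    with small have "2 * \<bar>Im (w x)\<bar> / cmod (w x) < 2 * \<delta>" by simp
    then show ?thesis using w_nz[of x] by (simp add: divide_less_eq mult_ac)
  qed
  have w0_nz: "w0 (X j) \<noteq> 0" if "j \<le> 2 * n + 1" for j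
    using pos[OF that] by (auto simp: w0_def)
  have w0_im: "\<delta> * cmod (w0 (X j)) \<le> (-1) ^ j * Im (w0 (X j))" if "j \<le> 2 * n + 1" for j
    using alt[OF that] w0_nz[OF that] by (simp add: w0_def field_simps)
  have "\<delta> \<le> 1"
  proof -
    have "\<bar>(-1) ^ 0 * Im (w0 (X 0))\<bar> \<le> cmod (w0 (X 0))" using abs_Im_le_cmod by simp
    then have "\<delta> * cmod (w0 (X 0)) \<le> 1 * cmod (w0 (X 0))" using w0_im[of 0] by simp
    then show ?thesis using w0_nz[of 0] by (simp add: mult_le_cancel_right)
  qed
  have Re_nz: "Re (w x) \<noteq> 0" if x: "x \<in> {-1..1}" for x
  proof
    assume "Re (w x) = 0"
    then have "\<bar>Im (w x)\<bar> = cmod (w x)" by (simp add: cmod_eq_Im)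
    then have "cmod (w x) < \<delta> * cmod (w x)" using w_im[OF x] by simp
    with \<open>\<delta> \<le> 1\<close> show False using mult_right_mono[of \<delta> 1 "cmod (w x)"] by simp
  qed
  define \<sigma> where "\<sigma> = sgn (Re (w 0))"
  have \<sigma>: "0 < \<sigma> * Re (w x)" if x: "x \<in> {-1..1}" for x
  proof (rule ccontr)
    assume neg: "\<not> 0 < \<sigma> * Re (w x)"
    let ?I = "(\<lambda>x. \<sigma> * Re (w x)) ` {-1..1}"
    have pos0: "0 < \<sigma> * Re (w 0)" using Re_nz[of 0] by (simp add: \<sigma>_def sgn_if)
    have "connected ?I"
      unfolding w_def by (intro connected_continuous_image continuous_intros) auto
    moreover have "\<sigma> * Re (w x) \<in> ?I" "\<sigma> * Re (w 0) \<in> ?I"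
      using x by (auto intro!: imageI)
    ultimately have "0 \<in> ?I"
      by (rule connectedD_interval) (use neg pos0 in linarith)+
    then obtain y where y: "y \<in> {-1..1}" "\<sigma> * Re (w y) = 0" by (auto simp del: mult_eq_0_iff)
    then show False using Re_nz[OF y(1)] pos0 by auto
  qed
  define f where "f = (\<lambda>x. Re (w x) * Im (w0 x) - Im (w x) * Re (w0 x))"
  define E where "E = poly_dag p * q - p * poly_dag q"
  have f_alt: "0 < \<sigma> * (-1) ^ j * f (X j)" if j: "j \<le> 2 * n + 1" for j
  proof -
    have "\<delta> * cmod (w0 (X j)) \<le> \<bar>Im (w0 (X j))\<bar>"
      using w0_im[OF j] abs_ge_self[of "(-1) ^ j * Im (w0 (X j))"] by (simp add: abs_mult)
    then have less: "\<bar>Im (w (X j)) * Re (w0 (X j))\<bar> < \<bar>Re (w (X j)) * Im (w0 (X j))\<bar>"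
      by (rule cross_sign[OF w_im[OF X_in[OF j]] _ w0_nz[OF j]])
    have "0 < \<delta> * cmod (w 0)" using w_im[of 0] by simp
    then have "0 < \<delta>" using w_nz[of 0] by (simp add: zero_less_mult_iff)
    then have "0 < \<delta> * cmod (w0 (X j))" using w0_nz[OF j] by simp
    then have "0 < (-1) ^ j * Im (w0 (X j))" using w0_im[OF j] by linarith
    then have pp: "0 < (\<sigma> * Re (w (X j))) * ((-1) ^ j * Im (w0 (X j)))"
      by (rule mult_pos_pos[OF \<sigma>[OF X_in[OF j]]])
    have s: "\<bar>\<sigma> * (-1) ^ j\<bar> = 1"
      using Re_nz[of 0] by (simp add: \<sigma>_def sgn_if abs_mult)
    have "\<bar>\<sigma> * (-1) ^ j * (Im (w (X j)) * Re (w0 (X j)))\<bar> < \<bar>\<sigma> * (-1) ^ j * (Re (w (X j)) * Im (w0 (X j)))\<bar>"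
      using less s by (simp add: abs_mult)
    with pp show ?thesis by (simp add: f_def algebra_simps)
  qed
  have Ef: "poly E (\<i> * of_real x) = of_real (2 * f x) * \<i>" for x
  proof -
    define e where "e = exp (\<i> * complex_of_real (\<omega> * x / 2))"
    have "cmod e = 1" by (simp add: e_def)
    then have "e * cnj e = 1" by (simp add: complex_norm_square[symmetric])
    then have "cnj (a * e) * (b * e) = cnj a * b" for a b
      by (metis complex_cnj_mult mult.assoc mult.commute mult.right_neutral)
    then have "cnj (w x) * w0 x = cnj (poly p (\<i> * of_real x)) * poly q (\<i> * of_real x)"
      "cnj (w0 x) * w x = cnj (poly q (\<i> * of_real x)) * poly p (\<i> * of_real x)"
      by (simp_all only: w_def w0_def twisted_def e_def[symmetric])
    then have "poly E (\<i> * of_real x) = cnj (w x) * w0 x - cnj (w0 x) * w x"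
      by (simp add: E_def poly_poly_dag)
    also have "\<dots> = of_real (2 * f x) * \<i>"
      by (simp add: f_def complex_eq_iff algebra_simps)
    finally show ?thesis .
  qed
  have "f (X 0) \<noteq> 0" using f_alt[of 0] by auto
  then have "E \<noteq> 0" using Ef[of "X 0"] by auto
  moreover have "continuous_on UNIV f"
    unfolding f_def w_def w0_def by (intro continuous_intros)
  ultimately have "2 * n + 1 \<le> degree E"
    by (intro alternation_imp_degree_ge[where f = f and X = X and \<sigma> = \<sigma>]) (use Ef X f_alt in auto)
  moreover have "degree E \<le> 2 * n"
    unfolding E_def using p(1) deg degree_poly_dag_le[of p] degree_poly_dag_le[of q]
    by (intro degree_diff_le order.trans[OF degree_mult_le]) linarith+
  ultimately show False by simp
qed

section \<open>Reverse Bessel polynomials\<close>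

text \<open>The reverse Bessel polynomials, with the argument reflected; \<open>\<theta>\<^sub>k\<close> in the comments. The
  quotient \<open>\<theta>\<^sub>k (-z) / \<theta>\<^sub>k (z)\<close> is the diagonal Pade approximant of \<open>exp (2 * z)\<close>.\<close>

fun bessel_poly :: "nat \<Rightarrow> complex poly" where
  "bessel_poly 0 = 1"
| "bessel_poly (Suc 0) = [:1, -1:]"
| "bessel_poly (Suc (Suc k)) =
     smult (of_nat (2 * k + 3)) (bessel_poly (Suc k)) + [:0, 0, 1:] * bessel_poly k"

text \<open>The double factorial \<open>(2k-1)!!\<close>, indexed by its number of factors.\<close>

definition odd_prod :: "nat \<Rightarrow> real" where
  "odd_prod k = (\<Prod>i<k. 2 * real i + 1)"

lemma odd_prod_pos: "0 < odd_prod k"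
  unfolding odd_prod_def by (intro prod_pos) auto

lemma odd_prod_Suc: "odd_prod (Suc k) = (2 * real k + 1) * odd_prod k"
  by (simp add: odd_prod_def)

lemma odd_prod_eq_fact: "odd_prod k * (2 ^ k * fact k) = fact (2 * k)"
proof (induction k)
  case (Suc k)
  have "odd_prod (Suc k) * (2 ^ Suc k * fact (Suc k))
      = (2 * real k + 1) * (2 * real k + 2) * (odd_prod k * (2 ^ k * fact k))"
    by (simp add: odd_prod_Suc algebra_simps)
  also have "\<dots> = fact (2 * Suc k)"
    unfolding Suc.IH by (simp add: algebra_simps)
  finally show ?case .
qed (simp add: odd_prod_def)

lemma degree_bessel_poly_le: "degree (bessel_poly k) \<le> k"
proof (induction k rule: bessel_poly.induct)
  case (3 k)
  have "degree ([:0, 0, 1:] * bessel_poly k) \<le> 2 + degree (bessel_poly k)"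
    by (rule order.trans[OF degree_mult_le]) simp
  with 3 show ?case
    by (auto intro!: degree_add_le order.trans[OF degree_smult_le])
qed auto

lemma bessel_poly_0: "poly (bessel_poly k) 0 = of_real (odd_prod k)"
  by (induction k rule: bessel_poly.induct) (simp_all add: odd_prod_def)

text \<open>Equivalently, \<open>\<theta>\<^sub>k\<^sub>+\<^sub>1 (z) * exp z\<close> has the derivative \<open>- z * \<theta>\<^sub>k (z) * exp z\<close>. This makes the
  remainders below iterated integrals, whose vanishing order grows by two in each step.\<close>

lemma pderiv_bessel_poly:
  "pderiv (bessel_poly (Suc k)) + bessel_poly (Suc k) = - [:0, 1:] * bessel_poly k"
proof (induction k rule: bessel_poly.induct)
  case 1
  then show ?case by (simp add: pderiv_pCons)
next
  case 2
  then show ?case by (simp add: pderiv_pCons pderiv_add pderiv_smult)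
next
  case (3 k)
  have a: "pderiv (bessel_poly (Suc (Suc k))) = - [:0, 1:] * bessel_poly (Suc k) - bessel_poly (Suc (Suc k))"
    "pderiv (bessel_poly (Suc k)) = - [:0, 1:] * bessel_poly k - bessel_poly (Suc k)"
    using 3 by (simp_all add: eq_diff_eq del: bessel_poly.simps)
  show ?case
    unfolding bessel_poly.simps(3)[of "Suc k"]
    unfolding pderiv_add pderiv_smult pderiv_mult a
    unfolding bessel_poly.simps(3)[of k]
    by (simp add: poly_eq_poly_eq_iff[symmetric] fun_eq_iff pderiv_pCons algebra_simps)
qed

text \<open>This is \<open>y^k\<close> times the Riccati-Bessel function \<open>y * j\<^sub>k (y)\<close>, where \<open>j\<^sub>k\<close> is the
  spherical Bessel function.\<close>

definition riccati :: "nat \<Rightarrow> real \<Rightarrow> real" where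
  "riccati k y = Im (poly (bessel_poly k) (\<i> * of_real y) * exp (\<i> * of_real y))"

lemma riccati_deriv: "(riccati (Suc k) has_real_derivative y * riccati k y) (at y)"
proof -
  let ?b = "bessel_poly (Suc k)"
  let ?z = "\<i> * complex_of_real y"
  let ?F = "\<lambda>z. poly ?b z * exp z"
  have "(?F has_field_derivative (poly (pderiv ?b + ?b) ?z * exp ?z)) (at ?z)"
    by (auto intro!: derivative_eq_intros simp: algebra_simps)
  then have F: "(?F has_field_derivative (- ?z * poly (bessel_poly k) ?z * exp ?z)) (at ?z)"
    unfolding pderiv_bessel_poly by simp
  have "((\<lambda>t. \<i> * complex_of_real t) has_vector_derivative \<i>) (at y)"
    by (auto intro!: derivative_eq_intros)
  from field_vector_diff_chain_at[OF this F]
  have "((\<lambda>t. ?F (\<i> * of_real t)) has_vector_derivative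
      (\<i> * (- ?z * poly (bessel_poly k) ?z * exp ?z))) (at y)"
    by (simp add: o_def)
  from bounded_linear.has_vector_derivative[OF bounded_linear_Im this]
  have "((\<lambda>t. Im (?F (\<i> * of_real t))) has_real_derivative
      Im (\<i> * (- ?z * poly (bessel_poly k) ?z * exp ?z))) (at y)"
    by (simp only: has_real_derivative_iff_has_vector_derivative)
  moreover have "Im (\<i> * (- ?z * poly (bessel_poly k) ?z * exp ?z)) = y * riccati k y"
    unfolding riccati_def by (simp add: algebra_simps)
  ultimately show ?thesis by (simp add: riccati_def[abs_def])
qed

lemma riccati_0: "riccati k 0 = 0"
  by (simp add: riccati_def bessel_poly_0)

text \<open>Integrate the estimate for \<open>k\<close>, multiplied by \<open>y\<close>, from \<open>0\<close>: there the function
  vanishes, since \<open>\<theta>\<^sub>k (0)\<close> is real.\<close>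

lemma riccati_asymp: "\<bar>riccati k y - y ^ (2 * k + 1) / odd_prod (Suc k)\<bar> \<le> \<bar>y\<bar> ^ (2 * k + 3)"
proof (induction k arbitrary: y)
  case 0
  have "riccati 0 y = sin y" by (simp add: riccati_def Im_exp)
  moreover have "norm ((sin y - y) - (sin 0 - 0)) \<le> \<bar>y\<bar> ^ 2 * norm (y - 0)"
  proof (rule field_differentiable_bound[of "{-\<bar>y\<bar>..\<bar>y\<bar>}"])
    fix t assume t: "t \<in> {-\<bar>y\<bar>..\<bar>y\<bar>}"
    show "((\<lambda>y. sin y - y) has_real_derivative cos t - 1) (at t within {-\<bar>y\<bar>..\<bar>y\<bar>})"
      by (auto intro!: derivative_eq_intros)
    have "\<bar>sin (t / 2)\<bar> ^ 2 \<le> \<bar>t / 2\<bar> ^ 2"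
      by (rule power_mono[OF abs_sin_x_le_abs_x abs_ge_zero])
    then have "4 * (sin (t / 2))\<^sup>2 \<le> \<bar>t\<bar> ^ 2" by (simp add: power_divide)
    moreover have "norm (cos t - 1) = 2 * (sin (t / 2))\<^sup>2"
      using cos_double_sin[of "t / 2"] by simp
    ultimately have "norm (cos t - 1) \<le> \<bar>t\<bar> ^ 2"
      using zero_le_power2[of "sin (t / 2)"] by linarith
    also have "\<dots> \<le> \<bar>y\<bar> ^ 2" using t by (intro power_mono) auto
    finally show "norm (cos t - 1) \<le> \<bar>y\<bar> ^ 2" .
  qed auto
  ultimately show ?case by (simp add: odd_prod_def eval_nat_numeral)
next
  case (Suc k)
  let ?g = "\<lambda>y. riccati (Suc k) y - y ^ (2 * k + 3) / odd_prod (Suc (Suc k))"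
  have D: "(?g has_real_derivative t * (riccati k t - t ^ (2 * k + 1) / odd_prod (Suc k))) (at t within S)" for t S
  proof (rule has_field_derivative_at_within)
    have "((\<lambda>y. y ^ (2 * k + 3) / odd_prod (Suc (Suc k))) has_real_derivative
        real (2 * k + 3) * t ^ (2 * k + 2) / odd_prod (Suc (Suc k))) (at t)"
      using DERIV_cdivide[OF DERIV_pow[of "2 * k + 3" t UNIV]] by simp
    moreover have "real (2 * k + 3) * t ^ (2 * k + 2) / odd_prod (Suc (Suc k))
        = t * (t ^ (2 * k + 1) / odd_prod (Suc k))"
      unfolding odd_prod_Suc[of "Suc k"] by (simp add: add.commute)
    ultimately show "(?g has_real_derivative t * (riccati k t - t ^ (2 * k + 1) / odd_prod (Suc k))) (at t)"
      unfolding right_diff_distrib by (intro DERIV_diff riccati_deriv) simp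
  qed
  have "norm (?g y - ?g 0) \<le> \<bar>y\<bar> ^ (2 * k + 4) * norm (y - 0)"
  proof (rule field_differentiable_bound[of "{-\<bar>y\<bar>..\<bar>y\<bar>}", OF _ D])
    fix t assume "t \<in> {-\<bar>y\<bar>..\<bar>y\<bar>}"
    then have t: "\<bar>t\<bar> \<le> \<bar>y\<bar>" by auto
    have "norm (t * (riccati k t - t ^ (2 * k + 1) / odd_prod (Suc k))) \<le> \<bar>t\<bar> * \<bar>t\<bar> ^ (2 * k + 3)"
      unfolding real_norm_def abs_mult by (intro mult_left_mono Suc.IH) auto
    also have "\<dots> = \<bar>t\<bar> ^ (2 * k + 4)" by (simp add: eval_nat_numeral)
    also have "\<dots> \<le> \<bar>y\<bar> ^ (2 * k + 4)" using t by (intro power_mono) auto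
    finally show "norm (t * (riccati k t - t ^ (2 * k + 1) / odd_prod (Suc k))) \<le> \<bar>y\<bar> ^ (2 * k + 4)" .
  qed auto
  also have "?g y - ?g 0 = ?g y" by (simp add: riccati_0)
  also have "\<bar>y\<bar> ^ (2 * k + 4) * norm (y - 0) = \<bar>y\<bar> ^ (2 * Suc k + 3)"
    by (simp add: eval_nat_numeral)
  finally show ?case by (simp add: eval_nat_numeral)
qed

section \<open>Chebyshev polynomials of odd degree\<close>

text \<open>The Chebyshev polynomial is \<open>T\<^sub>2\<^sub>n\<^sub>+\<^sub>1 (x) = x * odd_cheb n (x\<^sup>2)\<close>. Splitting off the odd part
  exhibits the coefficients of \<open>x^(2k+1)\<close>, and the recurrence is that of
  \<open>cos ((2n+1)t)\<close> with step \<open>2t\<close>.\<close>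

fun odd_cheb :: "nat \<Rightarrow> real poly" where
  "odd_cheb 0 = 1"
| "odd_cheb (Suc 0) = [:-3, 4:]"
| "odd_cheb (Suc (Suc n)) = [:-2, 4:] * odd_cheb (Suc n) - odd_cheb n"

lemma odd_cheb_cos: "cos t * poly (odd_cheb n) ((cos t)\<^sup>2) = cos ((2 * real n + 1) * t)"
proof (induction n rule: odd_cheb.induct)
  case 1
  then show ?case by simp
next
  case 2
  have "cos (3 * t) = 4 * cos t ^ 3 - 3 * cos t" by (rule cos_treble_cos)
  then show ?case by (simp add: power2_eq_square power3_eq_cube algebra_simps)
next
  case (3 n)
  define a where "a = (2 * real (Suc n) + 1) * t"
  have "(2 * real (Suc (Suc n)) + 1) * t = a + 2 * t" "(2 * real n + 1) * t = a - 2 * t"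
    by (simp_all add: a_def algebra_simps)
  then have "cos ((2 * real (Suc (Suc n)) + 1) * t)
      = (4 * (cos t)\<^sup>2 - 2) * cos a - cos ((2 * real n + 1) * t)"
    by (simp only: cos_add cos_diff cos_double_cos) (simp add: algebra_simps)
  then have "cos ((2 * real (Suc (Suc n)) + 1) * t)
      = (4 * (cos t)\<^sup>2 - 2) * cos ((2 * real (Suc n) + 1) * t) - cos ((2 * real n + 1) * t)"
    by (simp only: a_def)
  then show ?case
    unfolding 3[symmetric] by (simp add: algebra_simps)
qed

lemma degree_odd_cheb_le: "degree (odd_cheb n) \<le> n"
proof (induction n rule: odd_cheb.induct)
  case (3 n)
  have "degree ([:-2, 4:] * odd_cheb (Suc n)) \<le> 1 + degree (odd_cheb (Suc n))"
    by (rule order.trans[OF degree_mult_le]) simp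
  with 3 show ?case by (auto intro!: degree_diff_le)
qed auto

lemma coeff_odd_cheb_top: "coeff (odd_cheb n) n = 4 ^ n"
proof (induction n rule: odd_cheb.induct)
  case (3 n)
  have "coeff (odd_cheb n) (Suc (Suc n)) = 0" "coeff (odd_cheb (Suc n)) (Suc (Suc n)) = 0"
    using degree_odd_cheb_le[of n] degree_odd_cheb_le[of "Suc n"] by (auto intro!: coeff_eq_0)
  with 3 show ?case by simp
qed auto

definition cheb :: "nat \<Rightarrow> real \<Rightarrow> real" where
  "cheb n x = (\<Sum>k\<le>n. coeff (odd_cheb n) k * x ^ (2 * k + 1))"

lemma cheb_cos: "cheb n (cos t) = cos ((2 * real n + 1) * t)"
proof -
  have P: "poly (odd_cheb n) y = (\<Sum>k\<le>n. coeff (odd_cheb n) k * y ^ k)" for y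
    unfolding poly_altdef
    by (rule sum.mono_neutral_left) (use degree_odd_cheb_le[of n] in \<open>auto intro: coeff_eq_0\<close>)
  have "x ^ (2 * k + 1) = x * (x\<^sup>2) ^ k" for x :: real and k
    by (simp add: power_mult)
  then show ?thesis
    unfolding cheb_def odd_cheb_cos[symmetric] P by (simp only: sum_distrib_left mult_ac)
qed

lemma abs_cheb_le: "x \<in> {-1..1} \<Longrightarrow> \<bar>cheb n x\<bar> \<le> 1"
  using cheb_cos[of n "arccos x"] by (simp add: cos_arccos)

definition cheb_extremum :: "nat \<Rightarrow> nat \<Rightarrow> real" where
  "cheb_extremum n j = cos (real j * pi / (2 * real n + 1))"

lemma cheb_extremum_value: "cheb n (cheb_extremum n j) = (-1) ^ j"
proof -
  have "2 * real n + 1 \<noteq> 0" by (smt (verit) of_nat_0_le_iff)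
  then show ?thesis
    by (simp add: cheb_extremum_def cheb_cos cos_npi)
qed

lemma cheb_extremum_in: "cheb_extremum n j \<in> {-1..1}"
  by (simp add: cheb_extremum_def)

lemma cheb_extremum_less:
  assumes "j < 2 * n + 1"
  shows "cheb_extremum n (Suc j) < cheb_extremum n j"
  unfolding cheb_extremum_def
proof (rule cos_monotone_0_pi)
  have "real (Suc j) \<le> 2 * real n + 1" using assms by linarith
  then show "real (Suc j) * pi / (2 * real n + 1) \<le> pi"
    by (simp add: divide_le_eq mult.commute)
qed (use zero_le_mult_iff[of pi "real n"] in \<open>auto simp: field_simps add_pos_nonneg\<close>)

section \<open>A nearly optimal approximant\<close>

text \<open>The factor \<open>odd_prod (Suc k)\<close> cancels the leading coefficient of the \<open>k\<close>-th phase error,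
  and the power of \<open>s\<close> brings it to the common order \<open>s^(2n+1)\<close>; the coefficients of
  \<open>T\<^sub>2\<^sub>n\<^sub>+\<^sub>1\<close> then combine these errors.\<close>

definition trial :: "nat \<Rightarrow> real \<Rightarrow> complex poly" where
  "trial n s = (\<Sum>k\<le>n. smult (of_real (coeff (odd_cheb n) k * odd_prod (Suc k) * s ^ (2 * (n - k))))
     (pcompose (bessel_poly k) [:0, of_real s:]))"

lemma degree_trial_le: "degree (trial n s) \<le> n"
  unfolding trial_def
proof (intro degree_sum_le order.trans[OF degree_smult_le])
  fix k assume "k \<in> {..n}"
  then show "degree (pcompose (bessel_poly k) [:0, complex_of_real s:]) \<le> n"
    using degree_pcompose_le[of "bessel_poly k" "[:0, of_real s:]"] degree_bessel_poly_le[of k]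
    by (auto split: if_splits)
qed auto

lemma twisted_trial:
  "twisted (2 * s) (trial n s) x = (\<Sum>k\<le>n. of_real (coeff (odd_cheb n) k * odd_prod (Suc k) * s ^ (2 * (n - k)))
     * (poly (bessel_poly k) (\<i> * of_real (s * x)) * exp (\<i> * of_real (s * x))))"
  by (simp add: twisted_def trial_def poly_sum poly_pcompose sum_distrib_left sum_distrib_right mult_ac)

lemma Im_twisted_trial:
  obtains M where "\<And>s x. \<lbrakk>0 \<le> s; s \<le> 1; x \<in> {-1..1}\<rbrakk> \<Longrightarrow>
    \<bar>Im (twisted (2 * s) (trial n s) x) - s ^ (2 * n + 1) * cheb n x\<bar> \<le> M * s ^ (2 * n + 2)"
proof -
  define c where "c = (\<lambda>k. coeff (odd_cheb n) k)"
  define M where "M = (\<Sum>k\<le>n. \<bar>c k\<bar> * odd_prod (Suc k))"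
  have "\<bar>Im (twisted (2 * s) (trial n s) x) - s ^ (2 * n + 1) * cheb n x\<bar> \<le> M * s ^ (2 * n + 2)"
    if s: "0 \<le> s" "s \<le> 1" and x: "x \<in> {-1..1}" for s x
  proof -
    let ?e = "\<lambda>k. riccati k (s * x) - (s * x) ^ (2 * k + 1) / odd_prod (Suc k)"
    have "Im (of_real r * z) = r * Im z" for r z
      by simp
    then have "Im (twisted (2 * s) (trial n s) x) = (\<Sum>k\<le>n. c k * odd_prod (Suc k) * s ^ (2 * (n - k)) * riccati k (s * x))"
      unfolding twisted_trial Im_sum riccati_def c_def 
      by (simp only:)
    moreover have "s ^ (2 * n + 1) * cheb n x
       = (\<Sum>k\<le>n. c k * odd_prod (Suc k) * s ^ (2 * (n - k)) * ((s * x) ^ (2 * k + 1) / odd_prod (Suc k)))"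
      unfolding cheb_def sum_distrib_left c_def
    proof (intro sum.cong refl)
      fix k assume "k \<in> {..n}"
      then have "2 * (n - k) + (2 * k + 1) = 2 * n + 1" by simp
      then have split: "s ^ (2 * n + 1) = s ^ (2 * (n - k)) * s ^ (2 * k + 1)"
        by (simp only: flip: power_add)
      show "s ^ (2 * n + 1) * (coeff (odd_cheb n) k * x ^ (2 * k + 1)) =
        coeff (odd_cheb n) k * odd_prod (Suc k) * s ^ (2 * (n - k)) * ((s * x) ^ (2 * k + 1) / odd_prod (Suc k))"
        unfolding split power_mult_distrib using odd_prod_pos[of "Suc k"] by simp
    qed
    ultimately have "Im (twisted (2 * s) (trial n s) x) - s ^ (2 * n + 1) * cheb n x
      = (\<Sum>k\<le>n. c k * odd_prod (Suc k) * s ^ (2 * (n - k)) * ?e k)"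
      by (simp add: sum_subtractf right_diff_distrib)
    also have "\<bar>\<dots>\<bar> \<le> (\<Sum>k\<le>n. \<bar>c k\<bar> * odd_prod (Suc k) * s ^ (2 * n + 2))"
    proof (rule order.trans[OF sum_abs sum_mono])
      fix k assume k: "k \<in> {..n}"
      have "\<bar>?e k\<bar> \<le> \<bar>s * x\<bar> ^ (2 * k + 3)" by (rule riccati_asymp)
      also have "\<dots> \<le> s ^ (2 * k + 3)"
        using s x by (intro power_mono) (auto simp: abs_mult mult_left_le abs_le_iff)
      finally have "s ^ (2 * (n - k)) * \<bar>?e k\<bar> \<le> s ^ (2 * (n - k)) * s ^ (2 * k + 3)"
        using s by (intro mult_left_mono) auto
      also have "s ^ (2 * (n - k)) * s ^ (2 * k + 3) = s ^ (2 * n + 3)"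
      proof -
        have "2 * (n - k) + (2 * k + 3) = 2 * n + 3" using k by simp
        then show ?thesis by (simp only: flip: power_add)
      qed
      also have "\<dots> \<le> s ^ (2 * n + 2)" using s by (intro power_decreasing) auto
      finally have "(\<bar>c k\<bar> * odd_prod (Suc k)) * (s ^ (2 * (n - k)) * \<bar>?e k\<bar>)
          \<le> (\<bar>c k\<bar> * odd_prod (Suc k)) * s ^ (2 * n + 2)"
        using odd_prod_pos[of "Suc k"] by (intro mult_left_mono) auto
      then show "\<bar>c k * odd_prod (Suc k) * s ^ (2 * (n - k)) * ?e k\<bar> \<le> \<bar>c k\<bar> * odd_prod (Suc k) * s ^ (2 * n + 2)"
        using s odd_prod_pos[of "Suc k"] by (simp add: abs_mult mult.assoc)
    qed
    also have "\<dots> = M * s ^ (2 * n + 2)" by (simp add: M_def sum_distrib_right)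
    finally show ?thesis .
  qed
  then show ?thesis by (rule that)
qed

lemma poly_exp_lipschitz_0:
  fixes p :: "complex poly"
  obtains M where "0 \<le> M" "\<And>z. cmod z \<le> 1 \<Longrightarrow> cmod (poly p z * exp z - poly p 0) \<le> M * cmod z"
proof -
  let ?f = "\<lambda>z. poly p z * exp z"
  let ?f' = "\<lambda>z. poly (pderiv p) z * exp z + poly p z * exp z"
  have "compact (?f' ` cball 0 1)"
    by (intro compact_continuous_image continuous_intros) auto
  then have "bounded (?f' ` cball 0 1)" by (rule compact_imp_bounded)
  then obtain B where B: "\<And>z. z \<in> cball 0 1 \<Longrightarrow> norm (?f' z) \<le> B"
    unfolding bounded_iff ball_simps by metis
  have "norm (?f z - ?f 0) \<le> B * norm (z - 0)" if "cmod z \<le> 1" for z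
    by (rule field_differentiable_bound[of "cball 0 1", where f' = ?f'])
      (use B that in \<open>auto intro!: derivative_eq_intros simp: algebra_simps\<close>)
  moreover have "0 \<le> B" by (rule order.trans[OF norm_ge_zero B[of 0]]) simp
  ultimately show ?thesis using that[of B] by simp
qed

text \<open>The limit of \<open>trial n s\<close> for \<open>s \<rightarrow> 0\<close>: only the summand \<open>k = n\<close> carries no power of \<open>s\<close>.\<close>

definition trial_lim :: "nat \<Rightarrow> real" where
  "trial_lim n = 4 ^ n * odd_prod (Suc n) * odd_prod n"

lemma twisted_trial_lim:
  obtains M where "\<And>s x. \<lbrakk>0 \<le> s; s \<le> 1; x \<in> {-1..1}\<rbrakk> \<Longrightarrow>
    cmod (twisted (2 * s) (trial n s) x - of_real (trial_lim n)) \<le> M * s"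
proof -
  define a where "a = (\<lambda>k. coeff (odd_cheb n) k * odd_prod (Suc k))"
  define h where "h = (\<lambda>k z. poly (bessel_poly k) z * exp z)"
  have "\<exists>M. \<forall>s x. 0 \<le> s \<and> s \<le> 1 \<and> x \<in> {-1..1} \<longrightarrow>
     cmod (of_real (s ^ (2 * (n - k))) * h k (\<i> * of_real (s * x)) - (if k = n then of_real (odd_prod n) else 0)) \<le> M * s"
    if k: "k \<le> n" for k
  proof -
    obtain B where B: "0 \<le> B" "\<And>z. cmod z \<le> 1 \<Longrightarrow> cmod (h k z - poly (bessel_poly k) 0) \<le> B * cmod z"
      using poly_exp_lipschitz_0 unfolding h_def by metis
    have C: "cmod (h k (\<i> * of_real (s * x)) - of_real (odd_prod k)) \<le> B * s"
      if s: "0 \<le> s" "s \<le> 1" "x \<in> {-1..1}" for s x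
    proof -
      have le: "\<bar>s\<bar> * \<bar>x\<bar> \<le> s" using s by (auto simp: mult_left_le abs_le_iff)
      then have "cmod (h k (\<i> * of_real (s * x)) - of_real (odd_prod k)) \<le> B * cmod (\<i> * of_real (s * x))"
        using B(2)[of "\<i> * of_real (s * x)"] s by (simp add: norm_mult bessel_poly_0)
      also have "\<dots> \<le> B * s" using le B(1) by (intro mult_left_mono) (auto simp: norm_mult)
      finally show ?thesis .
    qed
    show ?thesis
    proof (cases "k = n")
      case True
      then show ?thesis using C by auto
    next
      case False
      have "cmod (of_real (s ^ (2 * (n - k))) * h k (\<i> * of_real (s * x))) \<le> (B + odd_prod k) * s"
        if s: "0 \<le> s" "s \<le> 1" "x \<in> {-1..1}" for s x
      proof -
        have "cmod (h k (\<i> * of_real (s * x))) \<le> B * s + odd_prod k"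
          using C[OF s] norm_triangle_ineq2[of "h k (\<i> * of_real (s * x))" "of_real (odd_prod k)"]
            odd_prod_pos[of k] by simp
        also have "\<dots> \<le> B + odd_prod k" using s B by (auto simp: mult_left_le)
        finally have 1: "cmod (h k (\<i> * of_real (s * x))) \<le> B + odd_prod k" .
        have "s ^ (2 * (n - k)) \<le> s ^ 1" using s False k by (intro power_decreasing) auto
        then have "s ^ (2 * (n - k)) * cmod (h k (\<i> * of_real (s * x))) \<le> s * (B + odd_prod k)"
          using 1 s by (intro mult_mono) auto
        then show ?thesis using s by (simp add: norm_mult norm_power mult.commute)
      qed
      then show ?thesis using False by auto
    qed
  qed
  then obtain M where M: "\<And>k s x. \<lbrakk>k \<le> n; 0 \<le> s; s \<le> 1; x \<in> {-1..1}\<rbrakk> \<Longrightarrow>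
     cmod (of_real (s ^ (2 * (n - k))) * h k (\<i> * of_real (s * x)) - (if k = n then of_real (odd_prod n) else 0)) \<le> M k * s"
    by metis
  have "cmod (twisted (2 * s) (trial n s) x - of_real (trial_lim n)) \<le> (\<Sum>k\<le>n. \<bar>a k\<bar> * M k) * s"
    if s: "0 \<le> s" "s \<le> 1" "x \<in> {-1..1}" for s x
  proof -
    let ?d = "\<lambda>k. of_real (s ^ (2 * (n - k))) * h k (\<i> * of_real (s * x)) - (if k = n then of_real (odd_prod n) else 0)"
    have "(\<Sum>k\<le>n. of_real (a k) * (if k = n then of_real (odd_prod n) else 0)) = complex_of_real (trial_lim n)"
      by (simp add: trial_lim_def a_def coeff_odd_cheb_top if_distrib[of "\<lambda>x. _ * x"] cong: if_cong)
    moreover have "twisted (2 * s) (trial n s) x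
        = (\<Sum>k\<le>n. of_real (a k) * (of_real (s ^ (2 * (n - k))) * h k (\<i> * of_real (s * x))))"
      unfolding twisted_trial a_def h_def by (simp only: of_real_mult mult.assoc)
    ultimately have "twisted (2 * s) (trial n s) x - of_real (trial_lim n) = (\<Sum>k\<le>n. of_real (a k) * ?d k)"
      by (simp only: right_diff_distrib sum_subtractf)
    also have "cmod \<dots> \<le> (\<Sum>k\<le>n. \<bar>a k\<bar> * (M k * s))"
    proof (rule sum_norm_le)
      fix k assume "k \<in> {..n}"
      then show "cmod (of_real (a k) * ?d k) \<le> \<bar>a k\<bar> * (M k * s)"
        unfolding norm_mult norm_of_real by (intro mult_left_mono M s) auto
    qed
    finally show ?thesis by (simp add: sum_distrib_right sum_distrib_left mult_ac)
  qed
  then show ?thesis by (rule that)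
qed

lemma trial_lim_pos: "0 < trial_lim n"
  by (simp add: trial_lim_def odd_prod_pos)

lemma trial_lim_eq_fact: "1 / trial_lim n = (fact n)\<^sup>2 / (fact (2 * n) * fact (2 * n + 1))"
proof -
  have four: "(4::real) ^ n = 2 ^ n * 2 ^ n" by (simp flip: power_mult_distrib)
  have "fact (2 * n) = odd_prod n * (2 ^ n * fact n)"
    by (rule odd_prod_eq_fact[symmetric])
  moreover from this have "fact (2 * n + 1) = odd_prod (Suc n) * (2 ^ n * fact n)"
    by (simp add: odd_prod_Suc algebra_simps)
  ultimately have "fact (2 * n) * fact (2 * n + 1) = trial_lim n * (fact n)\<^sup>2"
    by (simp only: trial_lim_def four power2_eq_square mult_ac)
  then show ?thesis using trial_lim_pos[of n] by (simp add: field_simps)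
qed

text \<open>Dividing the imaginary part, known up to \<open>O(s^(2n+2))\<close>, by the modulus, which is
  \<open>G + O(s)\<close>, costs only another \<open>O(s) * s^(2n+1)\<close>.\<close>

lemma trial_ratio:
  obtains K s0 where "0 < s0" "\<And>s x. \<lbrakk>0 < s; s < s0; x \<in> {-1..1}\<rbrakk> \<Longrightarrow>
      0 < Re (twisted (2 * s) (trial n s) x) \<and>
      \<bar>Im (twisted (2 * s) (trial n s) x) / cmod (twisted (2 * s) (trial n s) x)
        - s ^ (2 * n + 1) / trial_lim n * cheb n x\<bar> \<le> K * s ^ (2 * n + 2)"
proof -
  let ?G = "trial_lim n"
  note G = trial_lim_pos[of n]
  obtain M1 where M1: "\<And>s x. \<lbrakk>0 \<le> s; s \<le> 1; x \<in> {-1..1}\<rbrakk> \<Longrightarrow>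
      \<bar>Im (twisted (2 * s) (trial n s) x) - s ^ (2 * n + 1) * cheb n x\<bar> \<le> M1 * s ^ (2 * n + 2)"
    by (rule Im_twisted_trial[of n]) (rule that, blast+)
  obtain M2 where M2: "\<And>s x. \<lbrakk>0 \<le> s; s \<le> 1; x \<in> {-1..1}\<rbrakk> \<Longrightarrow>
      cmod (twisted (2 * s) (trial n s) x - of_real ?G) \<le> M2 * s"
    by (rule twisted_trial_lim[of n]) (rule that, blast+)
  define M where "M = max 1 (max M1 M2)"
  have M: "1 \<le> M" "M1 \<le> M" "M2 \<le> M" by (auto simp: M_def)
  \<comment> \<open>For \<open>s < s0\<close> the value of \<open>twisted\<close> stays within \<open>G / 2\<close> of its limit \<open>G\<close>.\<close>
  define s0 where "s0 = min 1 (?G / (2 * M))"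
  define K where "K = 2 * (?G * M + M) / ?G\<^sup>2"
  show ?thesis
  proof
    show "0 < s0" using G M by (simp add: s0_def)
    fix s x :: real
    assume s: "0 < s" "s < s0" and x: "x \<in> {-1..1}"
    define W where "W = twisted (2 * s) (trial n s) x"
    define t where "t = s ^ (2 * n + 1) * cheb n x"
    have s1: "s \<le> 1" and Ms: "M * s < ?G / 2"
      using s M by (auto simp: s0_def field_simps)
    have A: "\<bar>Im W - t\<bar> \<le> M * s ^ (2 * n + 2)"
      unfolding W_def t_def
      by (rule order.trans[OF M1 mult_right_mono[OF M(2)]]) (use s s1 x in auto)
    have B: "cmod (W - of_real ?G) \<le> M * s"
      unfolding W_def
      by (rule order.trans[OF M2 mult_right_mono[OF M(3)]]) (use s s1 x in auto)
    have t: "\<bar>t\<bar> \<le> s ^ (2 * n + 1)"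
      using abs_cheb_le[OF x, of n] s by (simp add: t_def abs_mult mult_left_le)
    have "\<bar>Re W - ?G\<bar> < ?G / 2" using abs_Re_le_cmod[of "W - of_real ?G"] B Ms by simp
    then have Re: "?G / 2 < Re W" by linarith
    then have W: "?G / 2 < cmod W" using complex_Re_le_cmod[of W] by linarith
    have D: "\<bar>cmod W - ?G\<bar> \<le> M * s"
      using norm_triangle_ineq3[of W "of_real ?G"] B G by simp
    \<comment> \<open>The numerator of \<open>Im W / cmod W - t / G\<close> over the common denominator.\<close>
    have "\<bar>?G * (Im W - t) + (?G - cmod W) * t\<bar> \<le> ?G * (M * s ^ (2 * n + 2)) + M * s * s ^ (2 * n + 1)"
    proof (rule order.trans[OF abs_triangle_ineq add_mono])
      show "\<bar>?G * (Im W - t)\<bar> \<le> ?G * (M * s ^ (2 * n + 2))"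
        using A G by (simp add: abs_mult)
      show "\<bar>(?G - cmod W) * t\<bar> \<le> M * s * s ^ (2 * n + 1)"
        unfolding abs_mult using D t s M by (intro mult_mono) auto
    qed
    also have "\<dots> = (?G * M + M) * s ^ (2 * n + 2)" by (simp add: algebra_simps)
    finally have num: "\<bar>?G * (Im W - t) + (?G - cmod W) * t\<bar> \<le> (?G * M + M) * s ^ (2 * n + 2)" .
    have "Im W / cmod W - t / ?G = (?G * (Im W - t) + (?G - cmod W) * t) / (?G * cmod W)"
    proof -
      have "cmod W \<noteq> 0" "?G \<noteq> 0" using G W by linarith+
      then show ?thesis by (simp add: field_simps)
    qed
    also have "\<bar>\<dots>\<bar> \<le> ((?G * M + M) * s ^ (2 * n + 2)) / (?G * (?G / 2))"
      unfolding abs_divide using num G W by (intro frac_le) auto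
    also have "\<dots> = K * s ^ (2 * n + 2)"
      by (simp add: K_def power2_eq_square)
    finally show "0 < Re (twisted (2 * s) (trial n s) x) \<and>
      \<bar>Im (twisted (2 * s) (trial n s) x) / cmod (twisted (2 * s) (trial n s) x)
        - s ^ (2 * n + 1) / ?G * cheb n x\<bar> \<le> K * s ^ (2 * n + 2)"
      using Re G by (simp add: W_def t_def)
  qed
qed

text \<open>The trial polynomial competes in the minimum, and its alternation at the Chebyshev extrema
  bounds every competitor from below.\<close>

lemma min_unitary_error_bounds:
  obtains K s0 where "0 < s0" "\<And>s. \<lbrakk>0 < s; s < s0\<rbrakk> \<Longrightarrow>
     \<bar>min_unitary_error n (2 * s) - 2 * (s ^ (2 * n + 1) / trial_lim n)\<bar> \<le> K * s ^ (2 * n + 2)"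
proof -
  obtain K s0 where s0: "0 < s0" and K: "\<And>s x. \<lbrakk>0 < s; s < s0; x \<in> {-1..1}\<rbrakk> \<Longrightarrow>
      0 < Re (twisted (2 * s) (trial n s) x) \<and>
      \<bar>Im (twisted (2 * s) (trial n s) x) / cmod (twisted (2 * s) (trial n s) x)
        - s ^ (2 * n + 1) / trial_lim n * cheb n x\<bar> \<le> K * s ^ (2 * n + 2)"
    by (rule trial_ratio[of n]) (rule that, blast+)
  show ?thesis
  proof
    show "0 < s0" by fact
    fix s assume s: "0 < s" "s < s0"
    define W where "W = twisted (2 * s) (trial n s)"
    define a where "a = s ^ (2 * n + 1) / trial_lim n"
    define b where "b = K * s ^ (2 * n + 2)"
    have a: "0 \<le> a" using s trial_lim_pos[of n] by (simp add: a_def)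
    have W: "0 < Re (W x)" "\<bar>Im (W x) / cmod (W x) - a * cheb n x\<bar> \<le> b" if "x \<in> {-1..1}" for x
      using K[OF s that] by (auto simp: W_def a_def b_def)
    obtain u where u: "u \<in> unitary_rat n" "min_unitary_error n (2 * s) = unitary_error (2 * s) u"
        "\<And>v. v \<in> unitary_rat n \<Longrightarrow> unitary_error (2 * s) u \<le> unitary_error (2 * s) v"
      using min_unitary_error_attained by blast
    have lower: "2 * (a - b) \<le> unitary_error (2 * s) u"
    proof (rule unitary_error_ge_alternation[where X = "cheb_extremum n",
        OF u(1) degree_trial_le cheb_extremum_less cheb_extremum_in])
      fix j :: nat
      let ?x = "cheb_extremum n j"
      show "0 < Re (twisted (2 * s) (trial n s) ?x)" using W(1)[OF cheb_extremum_in] by (simp add: W_def)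
      have "(-1) ^ j * (-1) ^ j = (1::real)" by (simp flip: power_mult_distrib)
      then have "a = (-1) ^ j * (a * (-1) ^ j)" by (simp add: mult.left_commute)
      then have "\<bar>(-1) ^ j * (Im (W ?x) / cmod (W ?x)) - a\<bar> = \<bar>(-1) ^ j * (Im (W ?x) / cmod (W ?x) - a * (-1) ^ j)\<bar>"
        by (simp only: right_diff_distrib)
      also have "\<dots> \<le> b" 
        unfolding abs_mult using W(2)[OF cheb_extremum_in, of n j] by (simp add: cheb_extremum_value)
      finally show "a - b \<le> (-1) ^ j * (Im (twisted (2 * s) (trial n s) ?x) / cmod (twisted (2 * s) (trial n s) ?x))"
        by (simp add: W_def)
    qed
    define v where "v = Fraction_Field.Fract (poly_dag (trial n s)) (trial n s)"
    have nz: "poly (trial n s) (\<i> * of_real x) \<noteq> 0" if "x \<in> {-1..1}" for x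
      using W(1)[OF that] by (auto simp: W_def twisted_def)
    have v: "v \<in> unitary_rat n"
      using nz[of 0] degree_trial_le[of n s] unfolding unitary_rat_def v_def by fastforce
    obtain x where x: "x \<in> {-1..1}" "unitary_error (2 * s) v = 2 * \<bar>Im (W x)\<bar> / cmod (W x)"
      using unitary_error_attained[OF v, of "2 * s"] error_eq_twisted[OF nz] 
      unfolding v_def W_def by metis
    have "\<bar>Im (W x) / cmod (W x)\<bar> \<le> a + b"
      using W(2)[OF x(1)] mult_left_mono[OF abs_cheb_le[OF x(1), of n] a] a
        abs_mult[of a "cheb n x"] by linarith
    then have "unitary_error (2 * s) v \<le> 2 * (a + b)" unfolding x(2) by simp
    then have "unitary_error (2 * s) u \<le> 2 * (a + b)" using u(3)[OF v] by simp
    with lower show "\<bar>min_unitary_error n (2 * s) - 2 * (s ^ (2 * n + 1) / trial_lim n)\<bar> \<le> (2 * K) * s ^ (2 * n + 2)"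
      unfolding u(2) a_def[symmetric] mult.assoc b_def[symmetric] by simp
  qed
qed

theorem proposition8p4:
  fixes n :: nat
  assumes "n \<ge> 1"
  shows "(\<lambda>\<omega>::real. min_unitary_error n \<omega>
            - 2 * (fact n)\<^sup>2 / (fact (2 * n) * fact (2 * n + 1)) * (\<omega> / 2) ^ (2 * n + 1))
          \<in> O[at_right 0](\<lambda>\<omega>. \<omega> ^ (2 * n + 2))"
proof -
  obtain K s0 where s0: "0 < s0" and K: "\<And>s. \<lbrakk>0 < s; s < s0\<rbrakk> \<Longrightarrow>
     \<bar>min_unitary_error n (2 * s) - 2 * (s ^ (2 * n + 1) / trial_lim n)\<bar> \<le> K * s ^ (2 * n + 2)"
    by (rule min_unitary_error_bounds[of n]) (rule that, blast+)
  have "eventually (\<lambda>\<omega>::real. \<omega> \<in> {0<..<2 * s0}) (at_right 0)"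
    using s0 by (intro eventually_at_right_real) auto
  then have "eventually (\<lambda>\<omega>::real. norm (min_unitary_error n \<omega>
            - 2 * (fact n)\<^sup>2 / (fact (2 * n) * fact (2 * n + 1)) * (\<omega> / 2) ^ (2 * n + 1))
     \<le> (K / 2 ^ (2 * n + 2)) * norm (\<omega> ^ (2 * n + 2))) (at_right 0)"
  proof eventually_elim
    case (elim \<omega>)
    have "2 * (fact n)\<^sup>2 / (fact (2 * n) * fact (2 * n + 1)) * (\<omega> / 2) ^ (2 * n + 1)
       = 2 * ((\<omega> / 2) ^ (2 * n + 1) * (1 / trial_lim n))"
      unfolding trial_lim_eq_fact by simp
    then show ?case
      using K[of "\<omega> / 2"] elim by (simp add: power_divide)
  qed
  then show ?thesis by (rule bigoI)
qed

end
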